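(* Let $l\in\mathbb{R}$ and let $n$ be an odd positive integer. Let $\mathbb{X}$ be a $3$-dimensional real polyhedral Banach space (that is, $\mathbb{R}^3$ with a norm) such that $B_{\mathbb{X}}$ is the prism with vertices $$\Bigl(\cos\tfrac{(j-1)\pi}{n}+ l,\ \sin\tfrac{(j-1)\pi}{n},\ 1\Bigr)\quad\text{and}\quad \Bigl(\cos\tfrac{(j-1)\pi}{n}- l,\ \sin\tfrac{(j-1)\pi}{n},\ -1\Bigr),\qquad j\in\{1,2,\ldots,2n\}.$$ Then $n(\mathbb{X})=\sin\frac{\pi}{2n}$.
   Context: All Banach spaces are real. For a Banach space $\mathbb{X}$, $B_{\mathbb{X}}$ and $S_{\mathbb{X}}$ are its closed unit ball and unit sphere, $\mathbb{X}^*$ is the dual space, and $L(\mathbb{X})$ is the space of bounded linear operators on $\mathbb{X}$ with the operator norm. For $T\in L(\mathbb{X})$ the numerical radius is $v(T)=\sup\{|x^*(Tx)|: x\in S_{\mathbb{X}},\ x^*\in S_{\mathbb{X}^*},\ x^*(x)=1\}$, and the numerical index is $n(\mathbb{X})=\inf\{v(T):T\in L(\mathbb{X}),\ \|T\|=1\}$. A finite-dimensional Banach space is polyhedral if its unit ball has only finitely many extreme points (its vertices); the unit ball is then the convex hull of its vertices. *)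

theory Defs
  imports "HOL-Analysis.Analysis"
begin

text \<open>
  The norms considered depend on real and integer parameters, so a normed space is given here by
  a norm that is a function on a real vector space, and not by an instance of the class
  \<open>real_normed_vector\<close>. The notions below are those of the normed space \<open>('a, N)\<close>; in particular
  the class norm of \<open>real ^ 3\<close> plays no role. In finite dimension completeness is automatic.
\<close>

definition is_norm :: "('a::real_vector \<Rightarrow> real) \<Rightarrow> bool" where
  "is_norm N \<longleftrightarrow>
     (\<forall>x. 0 \<le> N x) \<and> (\<forall>x. N x = 0 \<longleftrightarrow> x = 0) \<and>
     (\<forall>c x. N (c *\<^sub>R x) = \<bar>c\<bar> * N x) \<and> (\<forall>x y. N (x + y) \<le> N x + N y)"

definition unit_ball :: "('a::real_vector \<Rightarrow> real) \<Rightarrow> 'a set" where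
  "unit_ball N = {x. N x \<le> 1}"

definition unit_sphere :: "('a::real_vector \<Rightarrow> real) \<Rightarrow> 'a set" where
  "unit_sphere N = {x. N x = 1}"

definition bounded_operators ::
    "('a::real_vector \<Rightarrow> real) \<Rightarrow> ('b::real_vector \<Rightarrow> real) \<Rightarrow> ('a \<Rightarrow> 'b) set" where
  "bounded_operators N M = {T. linear T \<and> (\<exists>K. \<forall>x. M (T x) \<le> K * N x)}"

text \<open>The supremum is a genuine one for norms \<open>N\<close>, \<open>M\<close> and \<open>T \<in> bounded_operators N M\<close>.\<close>

definition operator_norm ::
    "('a::real_vector \<Rightarrow> real) \<Rightarrow> ('b::real_vector \<Rightarrow> real) \<Rightarrow> ('a \<Rightarrow> 'b) \<Rightarrow> real" where
  "operator_norm N M T = (SUP x\<in>unit_ball N. M (T x))"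

definition dual_unit_sphere :: "('a::real_vector \<Rightarrow> real) \<Rightarrow> ('a \<Rightarrow> real) set" where
  "dual_unit_sphere N = {f \<in> bounded_operators N abs. operator_norm N abs f = 1}"

definition numerical_radius :: "('a::real_vector \<Rightarrow> real) \<Rightarrow> ('a \<Rightarrow> 'a) \<Rightarrow> real" where
  "numerical_radius N T =
     Sup {\<bar>f (T x)\<bar> | x f. x \<in> unit_sphere N \<and> f \<in> dual_unit_sphere N \<and> f x = 1}"

definition numerical_index :: "('a::real_vector \<Rightarrow> real) \<Rightarrow> real" where
  "numerical_index N =
     Inf {numerical_radius N T | T. T \<in> bounded_operators N N \<and> operator_norm N N T = 1}"

definition polyhedral :: "('a::real_vector \<Rightarrow> real) \<Rightarrow> bool" where
  "polyhedral N \<longleftrightarrow> finite {x. x extreme_point_of unit_ball N}"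

definition prism_vertices :: "real \<Rightarrow> nat \<Rightarrow> (real ^ 3) set" where
  "prism_vertices l n =
     (\<Union>j\<in>{1..2 * n}.
       {vector [cos ((real j - 1) * pi / real n) + l, sin ((real j - 1) * pi / real n), 1],
        vector [cos ((real j - 1) * pi / real n) - l, sin ((real j - 1) * pi / real n), -1]})"

end

theory Submission
  imports Defs
begin

text \<open>
  Put \<open>\<delta> = pi / (2 n)\<close>. The shear \<open>(x, y, z) \<mapsto> (x - l z, y, z)\<close> turns the prism into the
  product of the regular \<open>2n\<close>-gon with vertices \<open>w\<^sub>k = (cos (2 k \<delta>), sin (2 k \<delta>))\<close> and the interval
  \<open>[-1, 1]\<close>, so the space is the \<open>\<infinity>\<close>-sum of a polygonal plane and a line. Its norm is the
  maximum of \<open>\<bar>z\<bar>\<close> and of the functionals \<open>F\<^sub>k\<close> that equal \<open>1\<close> on the lateral facets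
  (lemma \<open>norm_le_if_facets_le\<close>). The numerical index is computed from these functionals.

  Lower bound. Let \<open>v\<close> be the numerical radius of \<open>T\<close>. At a vertex of the facet of \<open>F\<^sub>k\<close> the
  functional \<open>F\<^sub>k \<circ> T\<close> is at most \<open>v\<close> in absolute value. Any other vertex \<open>w\<^sub>j\<close> of the polygon is
  \<open>\<alpha> w\<^sub>k + \<beta> w\<^sub>k\<^sub>+\<^sub>1\<close>, where \<open>\<alpha> + \<beta> = cos ((2 m - 1) \<delta>) / cos \<delta>\<close> and
  \<open>\<beta> - \<alpha> = sin ((2 m - 1) \<delta>) / sin \<delta>\<close> with \<open>m = j - k\<close>, whence \<open>\<bar>\<alpha>\<bar> + \<bar>\<beta>\<bar> \<le> 1 / sin \<delta>\<close>
  (lemma \<open>edge_coordinates\<close>). Thus \<open>F\<^sub>k \<circ> T\<close> is at most \<open>v / sin \<delta>\<close> at every vertex of the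
  prism; the contribution of the height is not enlarged, which does no harm as \<open>1 / sin \<delta> \<ge> 1\<close>.
  The functional \<open>z\<close> is \<open>\<plusminus> 1\<close> at every vertex, so \<open>z \<circ> T\<close> is even bounded by \<open>v\<close> there. Hence
  \<open>\<parallel>T\<parallel> \<le> v / sin \<delta>\<close>.

  Upper bound. Let \<open>T\<close> be the quarter turn of the plane of the polygon, scaled by the inradius
  \<open>cos \<delta>\<close> and extended by \<open>0\<close>. It maps the vertices of the polygon to the incircle, so
  \<open>\<parallel>T\<parallel> \<le> 1\<close>; for odd \<open>n\<close> the images are points where the incircle touches an edge, so
  \<open>\<parallel>T\<parallel> = 1\<close>. If \<open>f\<close> has norm \<open>1\<close> and \<open>f x = 1\<close>, then \<open>1 + t f (T x) \<le> \<parallel>x + t T x\<parallel>\<close>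
  for all \<open>t\<close>. For \<open>t = \<plusminus> sin \<delta> / (cos \<delta>)\<^sup>2\<close> the operator \<open>I + t T\<close> acts on the plane as a
  rotation by \<open>\<plusminus> \<delta>\<close> followed by the scaling with \<open>1 / cos \<delta>\<close>, so its norm is at most
  \<open>1 / (cos \<delta>)\<^sup>2\<close>. This yields \<open>\<bar>f (T x)\<bar> \<le> sin \<delta>\<close>.
\<close>

section \<open>Norms given as functions\<close>

lemma is_normD:
  assumes "is_norm N"
  shows "0 \<le> N x" "N x = 0 \<longleftrightarrow> x = 0" "N (c *\<^sub>R x) = \<bar>c\<bar> * N x" "N (x + y) \<le> N x + N y"
  using assms unfolding is_norm_def by blast+

lemma is_norm_minus:
  assumes "is_norm N"
  shows "N (- x) = N x"
  using is_normD(3)[OF assms, of "-1" x] by simp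

lemma convex_norm_sublevel:
  assumes "is_norm N" and "linear S"
  shows "convex {x. N (S x) \<le> r}"
proof (rule convexI)
  fix x y and a b :: real
  assume H: "x \<in> {x. N (S x) \<le> r}" "y \<in> {x. N (S x) \<le> r}" "0 \<le> a" "0 \<le> b" "a + b = 1"
  have "N (S (a *\<^sub>R x + b *\<^sub>R y)) \<le> a * N (S x) + b * N (S y)"
    using is_normD(4)[OF assms(1), of "a *\<^sub>R S x" "b *\<^sub>R S y"] H
    by (simp add: linear_add[OF assms(2)] linear_scale[OF assms(2)] is_normD(3)[OF assms(1)])
  also have "\<dots> \<le> a * r + b * r"
    using H by (intro add_mono mult_left_mono) auto
  also have "\<dots> = r"
    using H(5) by (simp flip: distrib_right)
  finally show "a *\<^sub>R x + b *\<^sub>R y \<in> {x. N (S x) \<le> r}" by simp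
qed

lemma linear_le_norm_of_ball:
  assumes N: "is_norm N" and M: "is_norm M" and "linear T"
    and ball: "\<And>x. N x \<le> 1 \<Longrightarrow> M (T x) \<le> K"
  shows "M (T x) \<le> K * N x"
proof (cases "x = 0")
  case True
  then show ?thesis
    using is_normD(2)[OF N, of 0] is_normD(2)[OF M, of 0] linear_0[OF \<open>linear T\<close>] by simp
next
  case False
  then have pos: "N x > 0"
    using is_normD(1,2)[OF N, of x] by simp
  have "M (T ((1 / N x) *\<^sub>R x)) \<le> K"
    by (rule ball) (use pos in \<open>simp add: is_normD(3)[OF N]\<close>)
  then show ?thesis
    using pos by (simp add: linear_scale[OF \<open>linear T\<close>] is_normD(3)[OF M] field_simps)
qed

lemma is_norm_abs: "is_norm (abs :: real \<Rightarrow> real)"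
  by (auto simp: is_norm_def abs_mult)

lemma bdd_above_operator_image:
  assumes N: "is_norm N" and M: "is_norm M" and T: "T \<in> bounded_operators N M"
  shows "bdd_above ((\<lambda>x. M (T x)) ` unit_ball N)"
proof -
  obtain K where K: "\<And>x. M (T x) \<le> K * N x"
    using T unfolding bounded_operators_def by blast
  have "M (T x) \<le> \<bar>K\<bar>" if "N x \<le> 1" for x
  proof -
    have "M (T x) \<le> \<bar>K\<bar> * N x"
      using K[of x] is_normD(1)[OF N, of x] by (meson abs_ge_self mult_right_mono order_trans)
    also have "\<dots> \<le> \<bar>K\<bar> * 1"
      using that by (intro mult_left_mono) auto
    finally show ?thesis by simp
  qed
  then show ?thesis
    by (auto simp: bdd_above_def unit_ball_def)
qed

lemma norm_le_operator_norm:
  assumes "is_norm N" "is_norm M" "T \<in> bounded_operators N M" "N x \<le> 1"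
  shows "M (T x) \<le> operator_norm N M T"
  unfolding operator_norm_def
  by (rule cSUP_upper[OF _ bdd_above_operator_image]) (use assms in \<open>auto simp: unit_ball_def\<close>)

lemma operator_norm_le:
  assumes "is_norm N" and "\<And>x. N x \<le> 1 \<Longrightarrow> M (T x) \<le> r"
  shows "operator_norm N M T \<le> r"
proof -
  have "(0 :: 'a) \<in> unit_ball N"
    using is_normD(2)[OF assms(1), of 0] by (simp add: unit_ball_def)
  then show ?thesis
    unfolding operator_norm_def using assms(2) by (intro cSUP_least) (auto simp: unit_ball_def)
qed

lemma contraction_of_norm_one:
  assumes N: "is_norm N" and M: "is_norm M" and T: "linear T"
    and le: "\<And>x. N x \<le> 1 \<Longrightarrow> M (T x) \<le> 1" and x: "N x \<le> 1" "1 \<le> M (T x)"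
  shows "T \<in> bounded_operators N M" and "operator_norm N M T = 1"
proof -
  show bdd: "T \<in> bounded_operators N M"
    using linear_le_norm_of_ball[OF N M T le] T unfolding bounded_operators_def by blast
  show "operator_norm N M T = 1"
    using operator_norm_le[of N M T 1, OF N le] norm_le_operator_norm[OF N M bdd x(1)] x(2)
    by linarith
qed

lemma dual_unit_sphereD:
  assumes "is_norm N" and f: "f \<in> dual_unit_sphere N"
  shows "linear f" and "\<bar>f x\<bar> \<le> N x"
proof -
  have f': "f \<in> bounded_operators N abs" "operator_norm N abs f = 1"
    using f by (auto simp: dual_unit_sphere_def)
  show lin: "linear f"
    using f' by (simp add: bounded_operators_def)
  have "\<bar>f y\<bar> \<le> 1" if "N y \<le> 1" for y
    using norm_le_operator_norm[OF assms(1) is_norm_abs f'(1) that] f'(2) by simp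
  then show "\<bar>f x\<bar> \<le> N x"
    using linear_le_norm_of_ball[OF assms(1) is_norm_abs lin, of 1 x] by simp
qed

lemma dual_unit_sphereI:
  assumes "is_norm N" and "linear f" and "\<And>y. N y \<le> 1 \<Longrightarrow> \<bar>f y\<bar> \<le> 1" and "N x \<le> 1" "f x = 1"
  shows "f \<in> dual_unit_sphere N" and "x \<in> unit_sphere N"
proof -
  show f: "f \<in> dual_unit_sphere N"
    using contraction_of_norm_one[of N abs f x] assms is_norm_abs
    by (auto simp: dual_unit_sphere_def)
  show "x \<in> unit_sphere N"
    using dual_unit_sphereD(2)[OF assms(1) f, of x] assms(4,5) by (simp add: unit_sphere_def)
qed

lemma le_numerical_radius:
  assumes N: "is_norm N" and T: "T \<in> bounded_operators N N"
    and x: "x \<in> unit_sphere N" and f: "f \<in> dual_unit_sphere N" and "f x = 1"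
  shows "\<bar>f (T x)\<bar> \<le> numerical_radius N T"
  unfolding numerical_radius_def
proof (rule cSup_upper)
  show "bdd_above {\<bar>f (T x)\<bar> |x f. x \<in> unit_sphere N \<and> f \<in> dual_unit_sphere N \<and> f x = 1}"
  proof (rule bdd_aboveI[where M = "operator_norm N N T"], clarify)
    fix x f
    assume "x \<in> unit_sphere N" "f \<in> dual_unit_sphere N"
    then show "\<bar>f (T x)\<bar> \<le> operator_norm N N T"
      using dual_unit_sphereD(2)[OF N, of f "T x"] norm_le_operator_norm[OF N N T, of x]
      unfolding unit_sphere_def mem_Collect_eq by linarith
  qed
  show "\<bar>f (T x)\<bar>
      \<in> {\<bar>f (T x)\<bar> |x f. x \<in> unit_sphere N \<and> f \<in> dual_unit_sphere N \<and> f x = 1}"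
    using x f \<open>f x = 1\<close> by blast
qed

text \<open>
  A bound on \<open>\<parallel>x + t T x\<parallel>\<close> and \<open>\<parallel>x - t T x\<parallel>\<close> for a single \<open>t > 0\<close> controls the numerical radius,
  because a functional with \<open>\<parallel>f\<parallel> = f x = 1\<close> sends these vectors to \<open>1 \<plusminus> t f (T x)\<close>.
\<close>

lemma numerical_value_le_of_perturbation:
  assumes N: "is_norm N" and f: "f \<in> dual_unit_sphere N" and "f x = 1" and "0 < t"
    and "N (x + t *\<^sub>R y) \<le> 1 + t * r" "N (x + (- t) *\<^sub>R y) \<le> 1 + t * r"
  shows "\<bar>f y\<bar> \<le> r"
proof -
  note lin = dual_unit_sphereD(1)[OF N f]
  have val: "f (x + c *\<^sub>R y) = 1 + c * f y" for c
    using \<open>f x = 1\<close> by (simp add: linear_add[OF lin] linear_scale[OF lin])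
  have "t * f y \<le> t * r" "t * (- f y) \<le> t * r"
    using dual_unit_sphereD(2)[OF N f, of "x + t *\<^sub>R y"] val[of t]
      dual_unit_sphereD(2)[OF N f, of "x + (- t) *\<^sub>R y"] val[of "- t"] assms(5,6)
    by auto
  then have "f y \<le> r" "- f y \<le> r"
    using \<open>0 < t\<close> by (simp_all only: mult_le_cancel_left_pos)
  then show ?thesis
    by linarith
qed

section \<open>Trigonometry of a regular polygon\<close>

lemma cos_sin_edge_coordinates:
  fixes a b x :: real
  shows "sin (b - a) * cos x = sin (b - x) * cos a + sin (x - a) * cos b"
    and "sin (b - a) * sin x = sin (b - x) * sin a + sin (x - a) * sin b"
  by (simp_all add: sin_diff algebra_simps)

text \<open>
  Odd multiples of \<open>\<delta> = pi / (2 n)\<close> have distance at least \<open>\<delta>\<close> from the multiples \<open>2 n q \<delta>\<close> of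
  \<open>pi\<close>, by parity. For the polygon this says that every vertex lies between the two lines through
  any pair of opposite edges.
\<close>

lemma abs_cos_odd_multiple_le:
  fixes i :: int
  assumes "odd i" and "n > 0" and d: "d = pi / (2 * real n)"
  shows "\<bar>cos (real_of_int i * d)\<bar> \<le> cos d"
proof -
  define q r where "q = i div (2 * int n)" and "r = i mod (2 * int n)"
  have i: "i = 2 * int n * q + r"
    by (simp add: q_def r_def)
  have "0 \<le> r" "r < 2 * int n"
    using \<open>n > 0\<close> by (simp_all add: r_def)
  moreover have "odd r"
    using \<open>odd i\<close> unfolding r_def by (simp add: dvd_mod_iff)
  ultimately have "1 \<le> r" "r \<le> 2 * int n - 1"
    by presburger+
  then have r: "1 \<le> real_of_int r" "real_of_int r \<le> 2 * real n - 1"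
    by linarith+
  have dpos: "d > 0" and nd: "2 * real n * d = pi"
    using \<open>n > 0\<close> by (auto simp: d)
  have lo: "d \<le> real_of_int r * d"
    using r(1) dpos by simp
  have hi: "real_of_int r * d \<le> pi - d"
    using mult_right_mono[OF r(2), of d] dpos nd by (simp add: algebra_simps)
  have "real_of_int i * d = real_of_int r * d + real_of_int q * (2 * real n * d)"
    by (subst i) (simp add: algebra_simps)
  then have eq: "cos (real_of_int i * d) = cos (real_of_int r * d) * cos (real_of_int q * pi)"
    unfolding nd using sin_zero_iff_int2[of "real_of_int q * pi"] by (auto simp: cos_add)
  have "cos (real_of_int r * d) \<le> cos d"
    by (rule cos_monotone_0_pi_le) (use lo hi dpos in auto)
  moreover have "cos (pi - d) \<le> cos (real_of_int r * d)"
    by (rule cos_monotone_0_pi_le) (use lo hi dpos in auto)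
  ultimately have "\<bar>cos (real_of_int r * d)\<bar> \<le> cos d"
    by (simp add: abs_le_iff)
  then show ?thesis
    using mult_mono[of "\<bar>cos (real_of_int r * d)\<bar>" "cos d" "\<bar>cos (real_of_int q * pi)\<bar>" 1]
    by (simp add: eq abs_mult)
qed

section \<open>The norm whose unit ball is the prism\<close>

text \<open>The inverse of the shear that makes the prism a right prism.\<close>

definition shear :: "real \<Rightarrow> real \<Rightarrow> real \<Rightarrow> real \<Rightarrow> real ^ 3" where
  "shear l u w z = vector [u + l * z, w, z]"

lemma shear_nth [simp]:
  "shear l u w z $ 1 = u + l * z" "shear l u w z $ 2 = w" "shear l u w z $ 3 = z"
  by (simp_all add: shear_def)

lemma shear_coordinates: "x = shear l (x $ 1 - l * x $ 3) (x $ 2) (x $ 3)"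
  by (simp add: vec_eq_iff forall_3)

lemma shear_add: "shear l u w z + shear l u' w' z' = shear l (u + u') (w + w') (z + z')"
  by (simp add: vec_eq_iff forall_3 algebra_simps)

lemma shear_minus: "- shear l u w z = shear l (- u) (- w) (- z)"
  by (simp add: vec_eq_iff forall_3)

lemma shear_scale: "c *\<^sub>R shear l u w z = shear l (c * u) (c * w) (c * z)"
  by (simp add: vec_eq_iff forall_3 algebra_simps)

locale prism_norm =
  fixes l :: real and n :: nat and N :: "real ^ 3 \<Rightarrow> real"
  assumes n_ge_2: "n \<ge> 2" and is_norm: "is_norm N"
    and unit_ball_eq: "unit_ball N = convex hull (prism_vertices l n)"
begin

definition \<delta> :: real where "\<delta> = pi / (2 * real n)"

definition vertex :: "int \<Rightarrow> real \<Rightarrow> real ^ 3" where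
  "vertex k z = shear l (cos (2 * real_of_int k * \<delta>)) (sin (2 * real_of_int k * \<delta>)) z"

text \<open>
  The midpoint of the edge from \<open>w\<^sub>k\<close> to \<open>w\<^sub>k\<^sub>+\<^sub>1\<close> has polar angle \<open>(2 k + 1) \<delta>\<close> and distance
  \<open>cos \<delta>\<close> from the centre, so this functional is \<open>1\<close> on the facet over that edge.
\<close>

definition facet :: "int \<Rightarrow> real ^ 3 \<Rightarrow> real" where
  "facet k x = ((x $ 1 - l * x $ 3) * cos ((2 * real_of_int k + 1) * \<delta>)
     + x $ 2 * sin ((2 * real_of_int k + 1) * \<delta>)) / cos \<delta>"

lemma delta_bounds: "0 < \<delta>" "2 * \<delta> \<le> pi / 2" "2 * real n * \<delta> = pi"
proof -
  show "0 < \<delta>" and eq: "2 * real n * \<delta> = pi"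
    using n_ge_2 by (auto simp: \<delta>_def)
  have "4 * \<delta> \<le> 2 * real n * \<delta>"
    using n_ge_2 \<open>0 < \<delta>\<close> by (intro mult_right_mono) auto
  then show "2 * \<delta> \<le> pi / 2"
    using eq by linarith
qed

lemma trig_pos: "0 < cos \<delta>" "0 < sin \<delta>" "0 < sin (2 * \<delta>)"
  using delta_bounds pi_gt_zero by (auto intro!: cos_gt_zero sin_gt_zero)

lemma linear_facet: "linear (facet k)"
  by (rule linearI) (simp_all add: facet_def add_divide_distrib algebra_simps diff_divide_distrib)

lemma facet_vertex:
  "facet k (vertex j z) = cos (real_of_int (2 * (j - k) - 1) * \<delta>) / cos \<delta>"
proof -
  have "real_of_int (2 * (j - k) - 1) * \<delta> = 2 * real_of_int j * \<delta> - (2 * real_of_int k + 1) * \<delta>"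
    by (simp add: algebra_simps)
  then show ?thesis
    by (simp add: facet_def vertex_def cos_diff)
qed

lemma facet_vertex_eq_1: "facet k (vertex k z) = 1" "facet k (vertex (k + 1) z) = 1"
  using trig_pos by (simp_all add: facet_vertex)

lemma abs_facet_vertex_le: "\<bar>facet k (vertex j z)\<bar> \<le> 1"
  using abs_cos_odd_multiple_le[of "2 * (j - k) - 1" n \<delta>] trig_pos n_ge_2
  by (simp add: facet_vertex \<delta>_def)

lemma prism_vertices_eq: "prism_vertices l n = {vertex k z |k z. z = 1 \<or> z = -1}"
proof (rule set_eqI, rule iffI)
  fix x assume "x \<in> prism_vertices l n"
  then obtain j :: nat where j: "j \<in> {1..2 * n}"
    and x: "x = vector [cos ((real j - 1) * pi / real n) + l, sin ((real j - 1) * pi / real n), 1] \<or>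
      x = vector [cos ((real j - 1) * pi / real n) - l, sin ((real j - 1) * pi / real n), -1]"
    unfolding prism_vertices_def by blast
  have "(real j - 1) * pi / real n = 2 * real_of_int (int j - 1) * \<delta>"
    using n_ge_2 by (simp add: \<delta>_def field_simps)
  then have "x = vertex (int j - 1) 1 \<or> x = vertex (int j - 1) (-1)"
    using x by (simp add: vertex_def shear_def)
  then show "x \<in> {vertex k z |k z. z = 1 \<or> z = -1}"
    by blast
next
  fix x assume "x \<in> {vertex k z |k z. z = 1 \<or> z = -1}"
  then obtain k z where x: "x = vertex k z" and z: "z = 1 \<or> z = -1"
    by blast
  define j where "j = nat (k mod (2 * int n)) + 1"
  define q where "q = k div (2 * int n)"
  have bound: "0 \<le> k mod (2 * int n)" "k mod (2 * int n) < 2 * int n"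
    using n_ge_2 by auto
  have k: "k = 2 * int n * q + (int j - 1)"
    using bound by (simp add: j_def q_def)
  have "2 * real_of_int k * \<delta> = 2 * (real j - 1) * \<delta> + 2 * real_of_int q * (2 * real n * \<delta>)"
    by (subst k) (simp add: algebra_simps)
  also have "\<dots> = (real j - 1) * pi / real n + 2 * pi * real_of_int q"
    using n_ge_2 delta_bounds(3) by (simp add: \<delta>_def field_simps)
  finally have "cos (2 * real_of_int k * \<delta>) = cos ((real j - 1) * pi / real n)"
    "sin (2 * real_of_int k * \<delta>) = sin ((real j - 1) * pi / real n)"
    by (simp_all add: cos_add sin_add)
  moreover have "j \<in> {1..2 * n}"
    using bound by (auto simp: j_def)
  ultimately show "x \<in> prism_vertices l n"
    using z unfolding x prism_vertices_def vertex_def shear_def by auto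
qed

lemma norm_image_le_of_vertices:
  assumes "linear S" and "is_norm M"
    and v: "\<And>k z. z = 1 \<or> z = -1 \<Longrightarrow> M (S (vertex k z)) \<le> r" and x: "N x \<le> 1"
  shows "M (S x) \<le> r"
proof -
  have "convex hull (prism_vertices l n) \<subseteq> {x. M (S x) \<le> r}"
    by (intro hull_minimal convex_norm_sublevel assms) (auto simp: prism_vertices_eq v)
  then show ?thesis
    using x unit_ball_eq by (auto simp: unit_ball_def)
qed

lemma norm_vertex_le:
  assumes "\<bar>z\<bar> \<le> 1"
  shows "N (vertex k z) \<le> 1"
proof -
  have end_le: "N (vertex k z) \<le> 1" if "z = 1 \<or> z = -1" for z
  proof -
    have "vertex k z \<in> unit_ball N"
      unfolding unit_ball_eq prism_vertices_eq using that by (intro hull_inc) blast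
    then show ?thesis by (simp add: unit_ball_def)
  qed
  have "vertex k z = ((1 + z) / 2) *\<^sub>R vertex k 1 + ((1 - z) / 2) *\<^sub>R vertex k (-1)"
    by (simp add: vertex_def shear_scale shear_add flip: distrib_right add_divide_distrib)
      (simp add: field_simps)
  then have "N (vertex k z) \<le> ((1 + z) / 2) * N (vertex k 1) + ((1 - z) / 2) * N (vertex k (-1))"
    using is_normD(4)[OF is_norm, of "((1 + z) / 2) *\<^sub>R vertex k 1" "((1 - z) / 2) *\<^sub>R vertex k (-1)"]
      assms by (simp add: is_normD(3)[OF is_norm])
  also have "\<dots> \<le> ((1 + z) / 2) * 1 + ((1 - z) / 2) * 1"
    using assms by (intro add_mono mult_left_mono end_le) auto
  finally show ?thesis by (simp add: field_simps)
qed

lemma abs_facet_le: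
  assumes "N x \<le> 1"
  shows "\<bar>facet k x\<bar> \<le> 1"
  using norm_image_le_of_vertices[OF linear_facet is_norm_abs abs_facet_vertex_le assms] .

lemma abs_height_le:
  assumes "N x \<le> 1"
  shows "\<bar>x $ 3\<bar> \<le> 1"
  by (rule norm_image_le_of_vertices[OF _ is_norm_abs _ assms])
    (auto simp: vertex_def intro!: linearI)

lemma facet_dual: "facet k \<in> dual_unit_sphere N"
  using dual_unit_sphereI(1)[OF is_norm linear_facet abs_facet_le, of "vertex k 1" k]
    norm_vertex_le[of 1 k] facet_vertex_eq_1 by simp

lemma facet_edge_sphere:
  assumes "\<bar>z\<bar> \<le> 1" and "facet k (vertex j z) = 1"
  shows "vertex j z \<in> unit_sphere N"
  using dual_unit_sphereI(2)[OF is_norm linear_facet abs_facet_le norm_vertex_le] assms by blast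

lemma height_dual: "(\<lambda>x. x $ 3) \<in> dual_unit_sphere N"
  by (rule dual_unit_sphereI(1)[OF is_norm _ abs_height_le norm_vertex_le[of 1 0]])
    (auto simp: vertex_def intro!: linearI)

text \<open>
  Every direction of the plane lies in one of the angular sectors spanned by consecutive vertices of
  the polygon; polar coordinates and the floor function find it.
\<close>

lemma sector_coordinates:
  obtains k \<alpha> \<beta> where "0 \<le> \<alpha>" "0 \<le> \<beta>"
    "u = \<alpha> * cos (2 * real_of_int k * \<delta>) + \<beta> * cos (2 * real_of_int (k + 1) * \<delta>)"
    "w = \<alpha> * sin (2 * real_of_int k * \<delta>) + \<beta> * sin (2 * real_of_int (k + 1) * \<delta>)"
proof -
  define \<rho> \<theta> where "\<rho> = cmod (Complex u w)" and "\<theta> = Arg (Complex u w)"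
  have uw: "u = \<rho> * cos \<theta>" "w = \<rho> * sin \<theta>"
    using rcis_cmod_Arg[of "Complex u w"] unfolding \<rho>_def \<theta>_def
    by (metis Re_rcis complex.sel(1), metis Im_rcis complex.sel(2))
  define k where "k = \<lfloor>\<theta> / (2 * \<delta>)\<rfloor>"
  define a b where "a = 2 * real_of_int k * \<delta>" and "b = 2 * real_of_int (k + 1) * \<delta>"
  have "real_of_int k \<le> \<theta> / (2 * \<delta>)" "\<theta> / (2 * \<delta>) \<le> real_of_int k + 1"
    unfolding k_def by linarith+
  then have ab: "a \<le> \<theta>" "\<theta> \<le> b"
    using delta_bounds(1) unfolding a_def b_def by (auto simp: field_simps)
  have ba: "b - a = 2 * \<delta>"
    by (simp add: a_def b_def algebra_simps)
  have "0 \<le> sin (b - \<theta>)" "0 \<le> sin (\<theta> - a)"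
    using ab ba delta_bounds(2) pi_gt_zero by (auto intro!: sin_ge_zero)
  moreover have "0 \<le> \<rho>"
    by (simp add: \<rho>_def)
  ultimately have "0 \<le> \<rho> * sin (b - \<theta>) / sin (2 * \<delta>)" "0 \<le> \<rho> * sin (\<theta> - a) / sin (2 * \<delta>)"
    using trig_pos(3) by auto
  moreover have
    "u = \<rho> * sin (b - \<theta>) / sin (2 * \<delta>) * cos a + \<rho> * sin (\<theta> - a) / sin (2 * \<delta>) * cos b"
    "w = \<rho> * sin (b - \<theta>) / sin (2 * \<delta>) * sin a + \<rho> * sin (\<theta> - a) / sin (2 * \<delta>) * sin b"
    using cos_sin_edge_coordinates[of b a \<theta>] trig_pos(3) unfolding ba uw
    by (simp_all add: field_simps)
  ultimately show thesis
    unfolding a_def b_def by (rule that)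
qed

text \<open>
  The plane component of a vector lies in the sector over some edge. The facet functional of that
  edge is the sum of its two coordinates in the sector, so if it is at most \<open>1\<close>, the plane component
  lies in the triangle spanned by the edge and the centre. At each height \<open>z\<close> in \<open>[-1, 1]\<close> the prism
  contains this triangle, as the centre is the midpoint of two opposite vertices.
\<close>

lemma norm_le_1_if_facets_le:
  assumes "\<And>k. facet k x \<le> 1" and z: "\<bar>x $ 3\<bar> \<le> 1"
  shows "N x \<le> 1"
proof -
  define z where "z = x $ 3"
  obtain k \<alpha> \<beta> where ab: "0 \<le> \<alpha>" "0 \<le> \<beta>"
    and u: "x $ 1 - l * x $ 3 =
      \<alpha> * cos (2 * real_of_int k * \<delta>) + \<beta> * cos (2 * real_of_int (k + 1) * \<delta>)"
    and w: "x $ 2 = \<alpha> * sin (2 * real_of_int k * \<delta>) + \<beta> * sin (2 * real_of_int (k + 1) * \<delta>)"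
    by (rule sector_coordinates)
  have x0: "x = shear l (x $ 1 - l * x $ 3) (x $ 2) z"
    unfolding z_def by (rule shear_coordinates)
  have "facet k x = \<alpha> * facet k (vertex k 0) + \<beta> * facet k (vertex (k + 1) 0)"
    unfolding facet_def u w vertex_def by (simp add: algebra_simps add_divide_distrib)
  then have sum: "\<alpha> + \<beta> \<le> 1"
    using assms(1)[of k] by (simp add: facet_vertex_eq_1)
  \<comment> \<open>\<open>- vertex k (- z)\<close> is the point at height \<open>z\<close> over the vertex opposite to \<open>w\<^sub>k\<close>; the first two
    coefficients differ by \<open>\<alpha>\<close> and complete \<open>\<beta>\<close> to total weight \<open>1\<close>.\<close>
  define p q where "p = (1 - \<beta> + \<alpha>) / 2" and "q = (1 - \<beta> - \<alpha>) / 2"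
  have pq: "0 \<le> p" "0 \<le> q" "p + q + \<beta> = 1" "p - q = \<alpha>"
    using ab sum by (auto simp: p_def q_def field_simps)
  have "p * z + q * z + \<beta> * z = z"
    using pq(3) by (metis distrib_right mult_1)
  then have "x = p *\<^sub>R vertex k z + q *\<^sub>R (- vertex k (- z)) + \<beta> *\<^sub>R vertex (k + 1) z"
    unfolding x0[unfolded u w] pq(4)[symmetric] vertex_def shear_minus shear_scale shear_add
    by (simp add: algebra_simps)
  then have "N x \<le> p * N (vertex k z) + q * N (vertex k (- z)) + \<beta> * N (vertex (k + 1) z)"
    using is_normD(4)[OF is_norm, of "p *\<^sub>R vertex k z" "q *\<^sub>R (- vertex k (- z))"]
      is_normD(4)[OF is_norm, of "p *\<^sub>R vertex k z + q *\<^sub>R (- vertex k (- z))"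
        "\<beta> *\<^sub>R vertex (k + 1) z"] ab pq
    by (simp add: is_normD(3)[OF is_norm] is_norm_minus[OF is_norm] del: scaleR_minus_right)
  also have "\<dots> \<le> p * 1 + q * 1 + \<beta> * 1"
    using z ab pq unfolding z_def by (intro add_mono mult_left_mono norm_vertex_le) auto
  finally show ?thesis
    using pq(3) by simp
qed

lemma norm_le_if_facets_le:
  assumes "\<And>k. facet k x \<le> r" and "\<bar>x $ 3\<bar> \<le> r"
  shows "N x \<le> r"
proof (rule field_le_epsilon)
  fix e :: real
  assume "0 < e"
  \<comment> \<open>The slack \<open>e\<close> allows division also when \<open>r = 0\<close>.\<close>
  then have pos: "0 < r + e"
    using assms(2) by linarith
  have "N ((1 / (r + e)) *\<^sub>R x) \<le> 1"
  proof (rule norm_le_1_if_facets_le)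
    show "facet k ((1 / (r + e)) *\<^sub>R x) \<le> 1" for k
      using assms(1)[of k] \<open>0 < e\<close> pos
      by (simp add: linear_scale[OF linear_facet] divide_le_eq)
    show "\<bar>((1 / (r + e)) *\<^sub>R x) $ 3\<bar> \<le> 1"
      using assms(2) \<open>0 < e\<close> pos by (simp add: abs_mult divide_le_eq)
  qed
  then show "N x \<le> r + e"
    using pos by (simp add: is_normD(3)[OF is_norm] divide_le_eq)
qed

text \<open>The circle of radius \<open>cos \<delta>\<close> is inscribed in the polygon.\<close>

lemma norm_shear_le_of_incircle:
  assumes uw: "u\<^sup>2 + w\<^sup>2 \<le> (r * cos \<delta>)\<^sup>2" and z: "\<bar>z\<bar> \<le> r"
  shows "N (shear l u w z) \<le> r"
proof (rule norm_le_if_facets_le)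
  fix k
  define a where "a = (2 * real_of_int k + 1) * \<delta>"
  have "(u * cos a + w * sin a)\<^sup>2 + (u * sin a - w * cos a)\<^sup>2
      = (u\<^sup>2 + w\<^sup>2) * ((sin a)\<^sup>2 + (cos a)\<^sup>2)"
    by algebra
  then have "(u * cos a + w * sin a)\<^sup>2 \<le> u\<^sup>2 + w\<^sup>2"
    using zero_le_power2[of "u * sin a - w * cos a"]
    unfolding sin_cos_squared_add mult_1_right by linarith
  then have "(u * cos a + w * sin a)\<^sup>2 \<le> (r * cos \<delta>)\<^sup>2"
    using uw by (rule order_trans)
  moreover have "0 \<le> r * cos \<delta>"
    using z trig_pos(1) by (intro mult_nonneg_nonneg) linarith+
  ultimately have "u * cos a + w * sin a \<le> r * cos \<delta>"
    by (rule power2_le_imp_le)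
  then show "facet k (shear l u w z) \<le> r"
    using trig_pos(1) by (simp add: facet_def a_def divide_le_eq)
qed (use z in simp)

section \<open>Lower bound for the numerical index\<close>

text \<open>
  With \<open>m = j - k\<close> the coordinates are \<open>\<alpha> = sin (2 (1 - m) \<delta>) / sin (2 \<delta>)\<close> and
  \<open>\<beta> = sin (2 m \<delta>) / sin (2 \<delta>)\<close>. Now \<open>\<bar>\<alpha>\<bar> + \<bar>\<beta>\<bar>\<close> is the larger one of \<open>\<bar>\<alpha> + \<beta>\<bar>\<close> and \<open>\<bar>\<beta> - \<alpha>\<bar>\<close>: the sum
  is the value of the facet functional at \<open>w\<^sub>j\<close>, hence at most \<open>1\<close>, and the difference is
  \<open>sin ((2 m - 1) \<delta>) / sin \<delta>\<close>.
\<close>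

lemma edge_coordinates:
  fixes j k :: int
  obtains \<alpha> \<beta> where "\<bar>\<alpha>\<bar> + \<bar>\<beta>\<bar> \<le> 1 / sin \<delta>"
    and "\<And>z. vertex j z = \<alpha> *\<^sub>R vertex k 0 + \<beta> *\<^sub>R vertex (k + 1) 0 + z *\<^sub>R shear l 0 0 1"
proof -
  define a b x where "a = 2 * real_of_int k * \<delta>" and "b = 2 * real_of_int (k + 1) * \<delta>"
    and "x = 2 * real_of_int j * \<delta>"
  define \<alpha> \<beta> where "\<alpha> = sin (b - x) / sin (2 * \<delta>)" and "\<beta> = sin (x - a) / sin (2 * \<delta>)"
  have ba: "b - a = 2 * \<delta>"
    by (simp add: a_def b_def algebra_simps)
  have cs: "cos x = \<alpha> * cos a + \<beta> * cos b" "sin x = \<alpha> * sin a + \<beta> * sin b"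
    using cos_sin_edge_coordinates[of b a x] trig_pos(3) unfolding ba \<alpha>_def \<beta>_def
    by (simp_all add: field_simps)
  have eq: "vertex j z = \<alpha> *\<^sub>R vertex k 0 + \<beta> *\<^sub>R vertex (k + 1) 0 + z *\<^sub>R shear l 0 0 1" for z
    unfolding vertex_def shear_scale shear_add
    using cs unfolding a_def b_def x_def by simp
  have "facet k (vertex j 0) = \<alpha> + \<beta>"
    unfolding eq by (simp add: linear_add[OF linear_facet] linear_scale[OF linear_facet]
        facet_vertex_eq_1)
  then have "\<bar>\<alpha> + \<beta>\<bar> * sin \<delta> \<le> 1 * 1"
    using abs_facet_vertex_le[of k j 0] trig_pos(2) by (intro mult_mono) auto
  then have sum: "\<bar>\<alpha> + \<beta>\<bar> \<le> 1 / sin \<delta>"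
    using trig_pos(2) by (simp add: le_divide_eq)
  define y where "y = x - (a + \<delta>)"
  have "sin (x - a) - sin (b - x) = 2 * sin y * cos \<delta>"
  proof -
    have "x - a = y + \<delta>" "b - x = \<delta> - y"
      using ba by (auto simp: y_def)
    then show ?thesis by (simp add: sin_add sin_diff)
  qed
  then have "\<beta> - \<alpha> = 2 * sin y * cos \<delta> / sin (2 * \<delta>)"
    unfolding \<alpha>_def \<beta>_def by (simp flip: diff_divide_distrib)
  then have "\<beta> - \<alpha> = sin y / sin \<delta>"
    using trig_pos(1) by (simp add: sin_double)
  then have "\<bar>\<beta> - \<alpha>\<bar> \<le> 1 / sin \<delta>"
    using trig_pos(2) abs_sin_le_one[of y] by (simp add: divide_right_mono)
  with sum have "\<bar>\<alpha>\<bar> + \<bar>\<beta>\<bar> \<le> 1 / sin \<delta>"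
    by linarith
  then show thesis
    using eq that by blast
qed

lemma operator_norm_le_numerical_radius:
  assumes T: "T \<in> bounded_operators N N"
  shows "operator_norm N N T \<le> numerical_radius N T / sin \<delta>"
proof (rule operator_norm_le[OF is_norm])
  define v where "v = numerical_radius N T"
  have lin: "linear T"
    using T by (simp add: bounded_operators_def)
  have facet_T: "\<bar>facet k (T (vertex i z))\<bar> \<le> v"
    if "i = k \<or> i = k + 1" "z = 1 \<or> z = -1" for k i z
    unfolding v_def
    by (rule le_numerical_radius[OF is_norm T facet_edge_sphere[of z k] facet_dual])
      (use that facet_vertex_eq_1 in auto)
  have height_T: "\<bar>T (vertex j z) $ 3\<bar> \<le> v" if "z = 1 \<or> z = -1" for j z
  proof -
    have "\<bar>(z *\<^sub>R T (vertex j z)) $ 3\<bar> \<le> v"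
      using le_numerical_radius[OF is_norm T _ height_dual, of "z *\<^sub>R vertex j z"] that
        facet_edge_sphere[of z j j] facet_vertex_eq_1
      by (auto simp: linear_scale[OF lin] v_def unit_sphere_def is_normD(3)[OF is_norm]
          linear_neg[OF lin] is_norm_minus[OF is_norm] vertex_def)
    then show ?thesis
      using that by auto
  qed
  have v_nonneg: "0 \<le> v"
    using height_T[of 1 0] by simp
  have s: "0 < sin \<delta>" "sin \<delta> \<le> 1"
    using trig_pos by auto
  have vertex_T: "N (T (vertex j z)) \<le> v / sin \<delta>" if z: "z = 1 \<or> z = -1" for j z
  proof (rule norm_le_if_facets_le)
    fix k
    define g where "g = facet k \<circ> T"
    have g: "linear g"
      unfolding g_def using lin linear_facet by (rule linear_compose)
    define q where "q = \<bar>g (shear l 0 0 1)\<bar>"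
    \<comment> \<open>Both \<open>g (w + e)\<close> and \<open>g (w - e)\<close> are bounded by \<open>v\<close>, so \<open>\<bar>g w\<bar> + \<bar>g e\<bar> \<le> v\<close>.\<close>
    have edge: "\<bar>g (vertex i 0)\<bar> \<le> v - q" if "i = k \<or> i = k + 1" for i
    proof -
      have split: "vertex i t = vertex i 0 + t *\<^sub>R shear l 0 0 1" for t
        unfolding vertex_def shear_scale shear_add by simp
      have "g (vertex i t) = g (vertex i 0) + t * g (shear l 0 0 1)" for t
        by (subst split) (simp add: linear_add[OF g] linear_scale[OF g])
      from this[of 1] this[of "-1"] show ?thesis
        using facet_T[OF that, of 1] facet_T[OF that, of "-1"]
        unfolding q_def g_def comp_apply by linarith
    qed
    have q: "0 \<le> q" "q \<le> v"
      using edge[of k] by (auto simp: q_def)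
    obtain \<alpha> \<beta> where ab: "\<bar>\<alpha>\<bar> + \<bar>\<beta>\<bar> \<le> 1 / sin \<delta>"
      and vj: "vertex j z = \<alpha> *\<^sub>R vertex k 0 + \<beta> *\<^sub>R vertex (k + 1) 0 + z *\<^sub>R shear l 0 0 1"
      using edge_coordinates[of j k] by metis
    have "facet k (T (vertex j z)) = g (vertex j z)"
      by (simp add: g_def)
    also have "\<dots> = \<alpha> * g (vertex k 0) + \<beta> * g (vertex (k + 1) 0) + z * g (shear l 0 0 1)"
      unfolding vj by (simp add: linear_add[OF g] linear_scale[OF g])
    also have "\<dots> \<le> \<bar>\<alpha> * g (vertex k 0)\<bar> + \<bar>\<beta> * g (vertex (k + 1) 0)\<bar> + \<bar>z * g (shear l 0 0 1)\<bar>"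
      by linarith
    also have "\<dots> \<le> \<bar>\<alpha>\<bar> * (v - q) + \<bar>\<beta>\<bar> * (v - q) + q"
      using edge[of k] edge[of "k + 1"] z unfolding abs_mult q_def[symmetric]
      by (intro add_mono mult_left_mono) auto
    also have "\<dots> = (\<bar>\<alpha>\<bar> + \<bar>\<beta>\<bar>) * (v - q) + 1 * q"
      by (simp add: algebra_simps)
    also have "\<dots> \<le> 1 / sin \<delta> * (v - q) + 1 / sin \<delta> * q"
      using q s by (intro add_mono mult_right_mono ab) (auto simp: le_divide_eq)
    also have "\<dots> = v / sin \<delta>"
      by (simp add: right_diff_distrib)
    finally show "facet k (T (vertex j z)) \<le> v / sin \<delta>" .
  next
    have "v \<le> v / sin \<delta>"
      using v_nonneg s by (simp add: le_divide_eq mult_left_le)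
    then show "\<bar>T (vertex j z) $ 3\<bar> \<le> v / sin \<delta>"
      using height_T[OF z, of j] by linarith
  qed
  show "N (T x) \<le> numerical_radius N T / sin \<delta>" if "N x \<le> 1" for x
    using norm_image_le_of_vertices[OF lin is_norm vertex_T that] by (simp add: v_def)
qed

section \<open>The extremal operator\<close>

definition quarter_turn :: "real ^ 3 \<Rightarrow> real ^ 3" where
  "quarter_turn x = shear l (- (cos \<delta> * x $ 2)) (cos \<delta> * (x $ 1 - l * x $ 3)) 0"

lemma linear_quarter_turn: "linear quarter_turn"
  by (rule linearI)
    (simp_all add: quarter_turn_def shear_add shear_scale vec_eq_iff forall_3 algebra_simps)

text \<open>
  A quarter turn advances by \<open>n / 2\<close> vertices. For odd \<open>n\<close> this is a half-integer, so the turned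
  vertices point to midpoints of edges: the image of \<open>w\<^sub>0\<close> is the midpoint of the edge from \<open>w\<^sub>p\<close>
  to \<open>w\<^sub>p\<^sub>+\<^sub>1\<close> with \<open>p = (n - 1) / 2\<close>.
\<close>

lemma quarter_turn_bounded_and_norm:
  assumes "odd n"
  shows "quarter_turn \<in> bounded_operators N N" and "operator_norm N N quarter_turn = 1"
proof -
  have "N (quarter_turn (vertex k z)) \<le> 1" for k z
    unfolding quarter_turn_def
    by (rule norm_shear_le_of_incircle)
      (simp_all add: vertex_def power_mult_distrib flip: distrib_left)
  then have le: "N (quarter_turn x) \<le> 1" if "N x \<le> 1" for x
    using norm_image_le_of_vertices[OF linear_quarter_turn is_norm _ that] by blast
  obtain p where p: "n = 2 * p + 1"
    using \<open>odd n\<close> by (rule oddE)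
  have rn: "2 * real_of_int (int p) + 1 = real n"
    using p by simp
  have angle: "(2 * real_of_int (int p) + 1) * \<delta> = pi / 2"
    unfolding rn using delta_bounds(3) by linarith
  have "facet (int p) (quarter_turn (vertex 0 1)) = 1"
    unfolding facet_def angle quarter_turn_def vertex_def using trig_pos(1) by simp
  then have ge: "1 \<le> N (quarter_turn (vertex 0 1))"
    using dual_unit_sphereD(2)[OF is_norm facet_dual, of "int p" "quarter_turn (vertex 0 1)"]
    by simp
  show "quarter_turn \<in> bounded_operators N N" and "operator_norm N N quarter_turn = 1"
    using contraction_of_norm_one[OF is_norm is_norm linear_quarter_turn le norm_vertex_le[of 1 0] ge]
    by auto
qed

lemma numerical_radius_quarter_turn_le: "numerical_radius N quarter_turn \<le> sin \<delta>"
  unfolding numerical_radius_def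
proof (rule cSup_least)
  show "{\<bar>f (quarter_turn x)\<bar> |x f. x \<in> unit_sphere N \<and> f \<in> dual_unit_sphere N \<and> f x = 1} \<noteq> {}"
    using facet_edge_sphere[of 1 0 0] facet_dual[of 0] facet_vertex_eq_1(1)[of 0 1] by auto
next
  define t where "t = sin \<delta> / (cos \<delta>)\<^sup>2"
  have tpos: "0 < t"
    using trig_pos by (simp add: t_def)
  have r_eq: "1 + t * sin \<delta> = 1 / (cos \<delta>)\<^sup>2"
    using trig_pos(1) sin_cos_squared_add[of \<delta>]
    by (simp add: t_def field_simps power2_eq_square)
  have r_ge: "1 \<le> 1 + t * sin \<delta>"
    using tpos trig_pos(2) by simp
  have perturbed: "N (x + c *\<^sub>R quarter_turn x) \<le> 1 + t * sin \<delta>"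
    if "N x \<le> 1" and c: "c = t \<or> c = - t" for x c
  proof (rule norm_image_le_of_vertices[OF _ is_norm _ \<open>N x \<le> 1\<close>])
    show "linear (\<lambda>x. x + c *\<^sub>R quarter_turn x)"
      by (intro linear_compose_add linear_compose_scale_right linear_quarter_turn linear_id[unfolded id_def])
    fix k and z :: real
    assume z: "z = 1 \<or> z = -1"
    define \<tau> where "\<tau> = c * cos \<delta>"
    define C S where "C = cos (2 * real_of_int k * \<delta>)" and "S = sin (2 * real_of_int k * \<delta>)"
    have CS: "C\<^sup>2 + S\<^sup>2 = 1"
      by (simp add: C_def S_def)
    have "t * cos \<delta> = sin \<delta> / cos \<delta>"
      using trig_pos(1) by (simp add: t_def power2_eq_square)
    then have "\<tau>\<^sup>2 = (sin \<delta> / cos \<delta>)\<^sup>2"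
      using c unfolding \<tau>_def by (metis mult_minus_left power2_minus)
    then have \<tau>: "1 + \<tau>\<^sup>2 = 1 / (cos \<delta>)\<^sup>2"
      using trig_pos(1) sin_cos_squared_add[of \<delta>] by (simp add: field_simps)
    have "(C - \<tau> * S)\<^sup>2 + (S + \<tau> * C)\<^sup>2 = (1 + \<tau>\<^sup>2) * (C\<^sup>2 + S\<^sup>2)"
      by (simp add: power2_eq_square algebra_simps)
    also have "\<dots> = ((1 + t * sin \<delta>) * cos \<delta>)\<^sup>2"
      unfolding CS \<tau> r_eq using trig_pos(1) by (simp add: power2_eq_square field_simps)
    finally have "N (shear l (C - \<tau> * S) (S + \<tau> * C) z) \<le> 1 + t * sin \<delta>"
      using z r_ge by (intro norm_shear_le_of_incircle) auto
    moreover have "vertex k z + c *\<^sub>R quarter_turn (vertex k z)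
        = shear l (C - \<tau> * S) (S + \<tau> * C) z"
      unfolding vertex_def quarter_turn_def shear_scale shear_add C_def S_def \<tau>_def
      by (simp add: mult.assoc)
    ultimately show "N (vertex k z + c *\<^sub>R quarter_turn (vertex k z)) \<le> 1 + t * sin \<delta>"
      by simp
  qed
  fix y
  assume "y \<in> {\<bar>f (quarter_turn x)\<bar> |x f. x \<in> unit_sphere N \<and> f \<in> dual_unit_sphere N \<and> f x = 1}"
  then obtain x f where y: "y = \<bar>f (quarter_turn x)\<bar>"
    and x: "N x \<le> 1" and f: "f \<in> dual_unit_sphere N" "f x = 1"
    by (auto simp: unit_sphere_def)
  show "y \<le> sin \<delta>"
    unfolding y
    by (rule numerical_value_le_of_perturbation[OF is_norm f tpos perturbed[OF x] perturbed[OF x]])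
      simp_all
qed

lemma numerical_index_prism:
  assumes "odd n"
  shows "numerical_index N = sin \<delta>"
proof -
  let ?R = "{numerical_radius N T |T. T \<in> bounded_operators N N \<and> operator_norm N N T = 1}"
  have lower: "sin \<delta> \<le> r" if "r \<in> ?R" for r
  proof -
    obtain T where T: "T \<in> bounded_operators N N" "operator_norm N N T = 1"
      and r: "r = numerical_radius N T"
      using \<open>r \<in> ?R\<close> by blast
    show ?thesis
      using operator_norm_le_numerical_radius[OF T(1)] T(2) trig_pos(2)
      by (simp add: r le_divide_eq)
  qed
  have mem: "numerical_radius N quarter_turn \<in> ?R"
    using quarter_turn_bounded_and_norm[OF assms] by blast
  have "Inf ?R \<le> numerical_radius N quarter_turn"
    by (rule cInf_lower[OF mem]) (use lower in \<open>auto intro!: bdd_belowI\<close>)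
  moreover have "sin \<delta> \<le> Inf ?R"
    by (rule cInf_greatest) (use mem lower in auto)
  ultimately show ?thesis
    unfolding numerical_index_def using numerical_radius_quarter_turn_le by linarith
qed

end

section \<open>The numerical index of the prism\<close>

text \<open>
  For \<open>n = 1\<close> the prism degenerates to a parallelogram in a plane, which absorbs no vector outside
  that plane.
\<close>

lemma prism_unit_ball_imp_ne_1:
  assumes N: "is_norm N" and ball: "unit_ball N = convex hull (prism_vertices l n)"
  shows "n \<noteq> 1"
proof
  assume "n = 1"
  have "prism_vertices l n \<subseteq> {x. x $ 2 = 0}"
  proof
    fix x assume "x \<in> prism_vertices l n"
    then obtain j :: nat where
      "x = vector [cos ((real j - 1) * pi / real n) + l, sin ((real j - 1) * pi / real n), 1] \<or>
       x = vector [cos ((real j - 1) * pi / real n) - l, sin ((real j - 1) * pi / real n), -1]"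
      unfolding prism_vertices_def by blast
    then have "x $ 2 = sin (real_of_int (int j - 1) * pi)"
      using \<open>n = 1\<close> by auto
    then show "x \<in> {x. x $ 2 = 0}"
      unfolding mem_Collect_eq using sin_zero_iff_int2 by metis
  qed
  moreover have "convex {x :: real ^ 3. x $ 2 = 0}"
    by (auto intro!: convexI)
  ultimately have flat: "unit_ball N \<subseteq> {x. x $ 2 = 0}"
    unfolding ball by (rule hull_minimal)
  define e :: "real ^ 3" where "e = axis 2 1"
  have e: "e $ 2 = 1" "e \<noteq> 0"
    by (auto simp: e_def axis_def vec_eq_iff)
  then have "N e > 0"
    using is_normD(1,2)[OF N, of e] by simp
  then have "(1 / N e) *\<^sub>R e \<in> unit_ball N"
    by (simp add: unit_ball_def is_normD(3)[OF N])
  then have "((1 / N e) *\<^sub>R e) $ 2 = 0"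
    using flat by blast
  then show False
    using e \<open>N e > 0\<close> by simp
qed

theorem theorem2p4:
  fixes l :: real and n :: nat and N :: "real ^ 3 \<Rightarrow> real"
  assumes "odd n"
    and "is_norm N"
    and "polyhedral N"
    and "unit_ball N = convex hull (prism_vertices l n)"
  shows "numerical_index N = sin (pi / (2 * real n))"
proof -
  have "n \<noteq> 1"
    using assms(2,4) by (rule prism_unit_ball_imp_ne_1)
  with \<open>odd n\<close> have "n \<ge> 2"
    by (cases n) auto
  then interpret prism_norm l n N
    using assms(2,4) by unfold_locales
  show ?thesis
    using numerical_index_prism[OF \<open>odd n\<close>] by (simp add: \<delta>_def)
qed

end
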